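(* Let $G$ be a connected finite $\delta$-hyperbolic graph and let $P(y,x)=(y=v_0,v_1,\dots,v_p=x)$ be an end-minimal shortest path from $y$ to $x$. (i) Any up-hill $(u,\dots,v)$ of $P(y,x)$ has height $d(u,v)\le\delta$. (ii) Any $c\in P(y,x)$ with $d(c,x)>2\delta$ satisfies $e(c)\le e(y)+\delta$ and $e(c)\le e(y)-d(c,y)+2\delta$. (iii) If $d(y,x)>4\delta+1$, then every vertex $v_i$ of $P(y,x)$ with $i\in[2\delta+1,p-2\delta-1]$ satisfies $e(v_i)<\min\{e(v_k): k\in[0,i-2\delta-1]\}$.
   Context: $G$ is $\delta$-hyperbolic if for any four vertices $u,v,w,x$ the two larger of $d(u,v)+d(w,x)$, $d(u,w)+d(v,x)$, $d(u,x)+d(v,w)$ differ by at most $2\delta$ ($d$ = shortest-path distance). $e(v)=\max_u d(v,u)$. A shortest path $P(y,x)$ from $y$ to $x$ is end-minimal if $e(x)\le e(v)$ for all $v\in P(y,x)$. An up-hill on $P(y,x)$ is a maximal by inclusion subpath $(v_i,\dots,v_{i+\ell})$ with $e(v_{j+1})>e(v_j)$ for all $j\in\{i,\dots,i+\ell-1\}$; $\ell$ is its height. *)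

theory Defs
  imports "Graph_Theory.Graph_Theory"
begin

(* Simple undirected graphs are the symmetric digraphs of locale graph.  Under unit weights
   the cost of a walk is its number of arcs.  In a connected graph the infimum is attained by
   a walk, so the conversion from ereal loses nothing. *)
definition gdist :: "('a, 'b) pre_digraph \<Rightarrow> 'a \<Rightarrow> 'a \<Rightarrow> real" where
  "gdist G u v = real_of_ereal (wf_digraph.\<mu> G (\<lambda>_. 1) u v)"

definition ecc :: "('a, 'b) pre_digraph \<Rightarrow> 'a \<Rightarrow> real" where
  "ecc G v = Max (gdist G v ` verts G)"

(* sort is ascending, so positions 1 and 2 hold the two larger sums. *)
definition hyperbolic :: "real \<Rightarrow> ('a, 'b) pre_digraph \<Rightarrow> bool" where
  "hyperbolic \<delta> G \<longleftrightarrow>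
    (\<forall>u \<in> verts G. \<forall>v \<in> verts G. \<forall>w \<in> verts G. \<forall>x \<in> verts G.
      let s = sort [gdist G u v + gdist G w x,
                    gdist G u w + gdist G v x,
                    gdist G u x + gdist G v w]
      in s ! 2 - s ! 1 \<le> 2 * \<delta>)"

definition shortest_path :: "('a, 'b) pre_digraph \<Rightarrow> 'a \<Rightarrow> 'a vwalk \<Rightarrow> 'a \<Rightarrow> bool" where
  "shortest_path G y P x \<longleftrightarrow>
    vpath P G \<and> hd P = y \<and> last P = x \<and> real (vwalk_length P) = gdist G y x"

definition end_minimal :: "('a, 'b) pre_digraph \<Rightarrow> 'a vwalk \<Rightarrow> bool" where
  "end_minimal G P \<longleftrightarrow> (\<forall>v \<in> set P. ecc G (last P) \<le> ecc G v)"

(* The pair i, l stands for the subpath P!i, ..., P!(i+l), which has l edges.  Since the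
   vertices of a path are distinct, inclusion of subpaths is inclusion of index intervals. *)
definition ascending_subpath :: "('a, 'b) pre_digraph \<Rightarrow> 'a vwalk \<Rightarrow> nat \<Rightarrow> nat \<Rightarrow> bool" where
  "ascending_subpath G P i l \<longleftrightarrow>
    i + l < length P \<and> (\<forall>j \<in> {i..<i + l}. ecc G (P ! (j + 1)) > ecc G (P ! j))"

definition up_hill :: "('a, 'b) pre_digraph \<Rightarrow> 'a vwalk \<Rightarrow> nat \<Rightarrow> nat \<Rightarrow> bool" where
  "up_hill G P i l \<longleftrightarrow>
    ascending_subpath G P i l \<and>
    (\<forall>i' l'. ascending_subpath G P i' l' \<and> {i..i + l} \<subseteq> {i'..i' + l'} \<longrightarrow> i' = i \<and> l' = l)"

end

theory Submission
  imports Defs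
begin

text \<open>
  Let \<open>c\<close> lie on a shortest path from \<open>y\<close> to \<open>x\<close> and let \<open>z\<close> be a vertex farthest from \<open>c\<close>.  The four-point
  condition for \<open>c, z, y, x\<close> gives
  \<open>e(c) \<le> max (e(y) - d(y,c)) (e(x) - d(c,x)) + 2\<delta>\<close>.  If \<open>e(x) \<le> e(c)\<close> and \<open>d(c,x) > 2\<delta>\<close>, the second
  alternative is impossible; the first one is the second bound of (ii), and applied with
  \<open>v\<^sub>k\<close> in place of \<open>y\<close> it gives (iii).  Averaging it with \<open>e(c) \<le> e(y) + d(y,c)\<close> gives the first bound of (ii).
  For (i), since eccentricities are integers, the eccentricity grows by exactly \<open>d(u,v)\<close> along an up-hill from \<open>u\<close> to \<open>v\<close>.  The first
  alternative for the triple \<open>u, v, x\<close> then bounds the height by \<open>\<delta>\<close>.  The second one gives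
  \<open>d(u,v) \<le> 2\<delta> - d(v,x)\<close>, while \<open>d(u,v) \<le> e(v) - e(x) \<le> d(v,x)\<close> by end-minimality.
\<close>

text \<open>Frees later arguments from \<open>sort\<close>: \<open>a\<close> exceeds the larger of
  the other two entries only when it is the largest, and then by exactly the gap between positions 2
  and 1. Sortedness makes that gap nonnegative.\<close>

lemma sort_three_gap:
  fixes a b c d :: real
  assumes "let s = sort [a, b, c] in s ! 2 - s ! 1 \<le> d"
  shows "a \<le> max b c + d" and "0 \<le> d"
  using assms by (auto simp: Let_def max_def numeral_2_eq_2 split: if_splits)

lemma nth_in_vwalk_arcs:
  "Suc i < length p \<Longrightarrow> (p ! i, p ! Suc i) \<in> set (vwalk_arcs p)"
proof (induction p arbitrary: i rule: vwalk_arcs.induct)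
  case (3 x y xs)
  then show ?case by (cases i) auto
qed auto

lemma hyperbolic_four_point:
  assumes "hyperbolic \<delta> G" "u \<in> verts G" "v \<in> verts G" "w \<in> verts G" "x \<in> verts G"
  shows "gdist G u v + gdist G w x
           \<le> max (gdist G u w + gdist G v x) (gdist G u x + gdist G v w) + 2 * \<delta>"
  using sort_three_gap(1) assms unfolding hyperbolic_def by blast

lemma hyperbolic_nonneg:
  assumes "hyperbolic \<delta> G" "u \<in> verts G"
  shows "0 \<le> \<delta>"
  using sort_three_gap(2)[of _ _ _ "2 * \<delta>"] assms unfolding hyperbolic_def by fastforce

section \<open>Distance and eccentricity in a connected graph\<close>

locale connected_graph = graph G for G :: "('a, 'b) pre_digraph" (structure) +
  assumes connected: "Digraph_Component.connected G"
begin

lemma awalk_cost_one: "awalk_cost (\<lambda>_. 1) p = real (length p)"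
  by (induction p) auto

lemma gdist_awalk:
  assumes "u \<in> verts G" "v \<in> verts G"
  obtains p where "awalk u p v" "gdist G u v = real (length p)"
proof -
  have "u \<rightarrow>\<^sup>* v"
    using symmetric_connected_imp_strongly_connected[OF sym_arcs connected] assms by blast
  then obtain p where "apath u p v" "\<mu> (\<lambda>_. 1) u v = ereal (awalk_cost (\<lambda>_. 1) p)"
    using min_cost_awalk[of u v "\<lambda>_. 1"] by auto
  then show thesis
    using that[of p] by (simp add: gdist_def awalk_cost_one apath_def)
qed

lemma gdist_le_length:
  assumes "awalk u p v"
  shows "gdist G u v \<le> real (length p)"
proof -
  have "u \<in> verts G" "v \<in> verts G" using assms by auto
  then have "u \<rightarrow>\<^sup>* v"
    using symmetric_connected_imp_strongly_connected[OF sym_arcs connected] by blast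
  \<comment> \<open>Showing that \<open>\<mu>\<close> takes a finite value lets the inequality
    between extended reals pass through \<open>real_of_ereal\<close>.\<close>
  then obtain q where "\<mu> (\<lambda>_. 1) u v = ereal (awalk_cost (\<lambda>_. 1) q)"
    using min_cost_awalk[of u v "\<lambda>_. 1"] by auto
  then show ?thesis
    using min_cost_le_walk_cost[OF assms, of "\<lambda>_. 1"] by (simp add: gdist_def awalk_cost_one)
qed

lemma gdist_Ints: "u \<in> verts G \<Longrightarrow> v \<in> verts G \<Longrightarrow> gdist G u v \<in> \<int>"
  by (metis gdist_awalk Ints_of_nat)

lemma gdist_self: "u \<in> verts G \<Longrightarrow> gdist G u u = 0"
  by (metis gdist_awalk gdist_le_length awalk_Nil_iff list.size(3) of_nat_0 of_nat_0_le_iff order_antisym)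

lemma gdist_triangle:
  assumes "u \<in> verts G" "v \<in> verts G" "w \<in> verts G"
  shows "gdist G u w \<le> gdist G u v + gdist G v w"
proof -
  obtain p q where "awalk u p v" "gdist G u v = real (length p)"
    "awalk v q w" "gdist G v w = real (length q)"
    by (metis gdist_awalk assms)
  then show ?thesis
    using gdist_le_length[of u "p @ q" w] by auto
qed

text \<open>Walks are lists of arcs, so reversal replaces each arc by an opposite one, which
  symmetry provides.\<close>

lemma awalk_reverse: "awalk u p v \<Longrightarrow> \<exists>q. awalk v q u \<and> length q = length p"
proof (induction p arbitrary: u)
  case (Cons e p)
  then have e: "e \<in> arcs G" "u = tail G e" and "awalk (head G e) p v"
    by (auto simp: awalk_Cons_iff)
  then obtain q where q: "awalk v q (head G e)" "length q = length p"
    using Cons.IH by blast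
  obtain e' where "e' \<in> arcs G" "tail G e = head G e'" "head G e = tail G e'"
    using e sym_arcs unfolding symmetric_conv by blast
  then have "awalk v (q @ [e']) u"
    using q e by (auto simp: awalk_simps)
  then show ?case using q by (intro exI[of _ "q @ [e']"]) simp
qed (auto simp: awalk_Nil_iff)

lemma gdist_commute:
  assumes "u \<in> verts G" "v \<in> verts G"
  shows "gdist G u v = gdist G v u"
  by (metis assms gdist_awalk gdist_le_length awalk_reverse order_antisym)

lemma gdist_le_ecc: "u \<in> verts G \<Longrightarrow> v \<in> verts G \<Longrightarrow> gdist G v u \<le> ecc G v"
  unfolding ecc_def by (intro Max_ge) auto

lemma ecc_attained:
  assumes "v \<in> verts G"
  obtains z where "z \<in> verts G" "ecc G v = gdist G v z"
proof -
  have "ecc G v \<in> gdist G v ` verts G"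
    unfolding ecc_def using assms by (intro Max_in) auto
  then show thesis using that by blast
qed

lemma ecc_Ints: "v \<in> verts G \<Longrightarrow> ecc G v \<in> \<int>"
  by (metis ecc_attained gdist_Ints)

lemma ecc_le_ecc_plus_gdist:
  assumes "u \<in> verts G" "v \<in> verts G"
  shows "ecc G u \<le> ecc G v + gdist G v u"
proof -
  obtain z where z: "z \<in> verts G" "ecc G u = gdist G u z"
    using ecc_attained assms by blast
  then have "gdist G u z \<le> gdist G u v + gdist G v z"
    using gdist_triangle assms by blast
  then show ?thesis
    using z assms gdist_le_ecc[of z v] gdist_commute[of u v] by simp
qed

section \<open>Eccentricity along a geodesic under hyperbolicity\<close>

lemma ecc_between_le_max:
  assumes hyp: "hyperbolic \<delta> G"
    and V: "y \<in> verts G" "c \<in> verts G" "x \<in> verts G"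
    and between: "gdist G y c + gdist G c x = gdist G y x"
  shows "ecc G c \<le> max (ecc G y - gdist G y c) (ecc G x - gdist G c x) + 2 * \<delta>"
proof -
  obtain z where z: "z \<in> verts G" "ecc G c = gdist G c z"
    using ecc_attained V by blast
  \<comment> \<open>The pairing puts \<open>ecc G c\<close> next to \<open>gdist G y x\<close>.
    Splitting the latter at \<open>c\<close> cancels \<open>gdist G c y\<close> in the first
    alternative and \<open>gdist G c x\<close> in the second.\<close>
  have "gdist G c z + gdist G y x
          \<le> max (gdist G c y + gdist G z x) (gdist G c x + gdist G z y) + 2 * \<delta>"
    using hyperbolic_four_point[OF hyp] V z by blast
  moreover have "gdist G z x \<le> ecc G x" "gdist G z y \<le> ecc G y" "gdist G c y = gdist G y c"
    using z V gdist_le_ecc gdist_commute by metis+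
  ultimately show ?thesis using z between by linarith
qed

lemma ecc_between_le:
  assumes "hyperbolic \<delta> G"
    and V: "y \<in> verts G" "c \<in> verts G" "x \<in> verts G"
    and "gdist G y c + gdist G c x = gdist G y x"
    and "ecc G x \<le> ecc G c" "gdist G c x > 2 * \<delta>"
  shows "ecc G c \<le> ecc G y - gdist G y c + 2 * \<delta>" and "ecc G c \<le> ecc G y + \<delta>"
proof -
  show "ecc G c \<le> ecc G y - gdist G y c + 2 * \<delta>"
    \<comment> \<open>The alternative through \<open>x\<close> would give
      \<open>ecc G c < ecc G x\<close>, against the assumption.\<close>
    using ecc_between_le_max[OF assms(1-5)] assms(6,7) by linarith
  then show "ecc G c \<le> ecc G y + \<delta>"
    using ecc_le_ecc_plus_gdist[OF V(2,1)] by linarith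
qed

lemma ecc_rise_le:
  assumes "hyperbolic \<delta> G"
    and V: "u \<in> verts G" "v \<in> verts G" "x \<in> verts G"
    and "gdist G u v + gdist G v x = gdist G u x"
    and "ecc G x \<le> ecc G u" "ecc G v \<ge> ecc G u + gdist G u v"
  shows "gdist G u v \<le> \<delta>"
  \<comment> \<open>In the alternative through \<open>x\<close>, adding
    \<open>gdist G u v \<le> 2 * \<delta> - gdist G v x\<close> and
    \<open>gdist G u v \<le> gdist G v x\<close> cancels \<open>gdist G v x\<close>.\<close>
  using ecc_between_le_max[OF assms(1-5)] assms(6,7) ecc_le_ecc_plus_gdist[OF V(2,3)]
    gdist_commute[OF V(2,3)] by linarith

section \<open>Indexed vertices of a shortest path\<close>

context
  fixes y P x
  assumes shortest: "shortest_path G y P x"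
begin

lemma shortest_path_nth_in_verts: "i < length P \<Longrightarrow> P ! i \<in> verts G"
  using shortest unfolding shortest_path_def vpath_def vwalk_def by auto

lemma shortest_path_not_Nil: "P \<noteq> []"
  using shortest unfolding shortest_path_def vpath_def vwalk_def by auto

lemma shortest_path_hd: "y = P ! 0"
  using shortest shortest_path_not_Nil unfolding shortest_path_def by (auto simp: hd_conv_nth)

lemma shortest_path_last: "x = P ! (length P - 1)"
  using shortest shortest_path_not_Nil unfolding shortest_path_def by (auto simp: last_conv_nth)

lemma gdist_step_le:
  assumes "Suc i < length P"
  shows "gdist G (P ! i) (P ! Suc i) \<le> 1"
proof -
  have "(P ! i, P ! Suc i) \<in> arcs_ends G"
    using nth_in_vwalk_arcs[OF assms] shortest
    unfolding shortest_path_def vpath_def vwalk_def by blast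
  then obtain e where "e \<in> arcs G" "tail G e = P ! i" "head G e = P ! Suc i"
    by (auto simp: arcs_ends_conv)
  then have "awalk (P ! i) [e] (P ! Suc i)"
    using head_in_verts[of e] by (simp add: awalk_simps)
  from gdist_le_length[OF this] show ?thesis by simp
qed

lemma gdist_segment_le:
  "i + l < length P \<Longrightarrow> gdist G (P ! i) (P ! (i + l)) \<le> real l"
proof (induction l)
  case 0
  then show ?case using gdist_self shortest_path_nth_in_verts by simp
next
  case (Suc l)
  then have "gdist G (P ! i) (P ! (i + Suc l))
      \<le> gdist G (P ! i) (P ! (i + l)) + gdist G (P ! (i + l)) (P ! (i + Suc l))"
    by (intro gdist_triangle shortest_path_nth_in_verts) auto
  then show ?case using Suc gdist_step_le[of "i + l"] by simp
qed

text \<open>The three pieces cut off at \<open>i\<close> and \<open>j\<close> have distances at most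
  their numbers of edges, while these distances sum to at least the length of the whole path; hence
  each bound is attained.\<close>

lemma gdist_segment:
  assumes "i \<le> j" "j < length P"
  shows "gdist G (P ! i) (P ! j) = real j - real i"
proof -
  let ?n = "length P - 1"
  have V: "P ! 0 \<in> verts G" "P ! i \<in> verts G" "P ! j \<in> verts G" "P ! ?n \<in> verts G"
    using assms shortest_path_not_Nil by (auto intro: shortest_path_nth_in_verts)
  have "real ?n = gdist G (P ! 0) (P ! ?n)"
    using shortest shortest_path_hd shortest_path_last by (simp add: shortest_path_def)
  also have "\<dots> \<le> gdist G (P ! 0) (P ! i) + gdist G (P ! i) (P ! j) + gdist G (P ! j) (P ! ?n)"
    using gdist_triangle[OF V(1,2,4)] gdist_triangle[OF V(2,3,4)] by linarith
  finally show ?thesis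
    using gdist_segment_le[of 0 i] gdist_segment_le[of i "j - i"] gdist_segment_le[of j "?n - j"]
      assms shortest_path_not_Nil by (simp add: of_nat_diff)
qed

lemma ecc_ascending_subpath:
  assumes "ascending_subpath G P i l"
  shows "ecc G (P ! i) + real l \<le> ecc G (P ! (i + l))"
  using assms
proof (induction l)
  case (Suc l)
  then have "i + Suc l < length P" and less: "ecc G (P ! (i + l)) < ecc G (P ! (i + Suc l))"
    by (auto simp: ascending_subpath_def)
  then have "ecc G (P ! (i + l)) \<in> \<int>" "ecc G (P ! (i + Suc l)) \<in> \<int>"
    by (auto intro!: ecc_Ints shortest_path_nth_in_verts)
  then have "ecc G (P ! (i + l)) + 1 \<le> ecc G (P ! (i + Suc l))"
    using less by (auto elim!: Ints_cases)
  moreover have "ascending_subpath G P i l"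
    using Suc.prems by (auto simp: ascending_subpath_def)
  ultimately show ?case using Suc.IH by simp
qed simp

context
  fixes \<delta>
  assumes hyp: "hyperbolic \<delta> G" and end_min: "end_minimal G P"
begin

lemma ecc_end_le: "i < length P \<Longrightarrow> ecc G (P ! (length P - 1)) \<le> ecc G (P ! i)"
  using end_min shortest_path_not_Nil by (simp add: end_minimal_def last_conv_nth)

text \<open>The start is a free index \<open>k\<close>: \<open>k = 0\<close> serves claim (ii), and
  every admissible \<open>k\<close> is compared with \<open>i\<close> in claim (iii).\<close>

lemma ecc_path_le:
  assumes "k \<le> i" "i < length P" "real (length P - 1) - real i > 2 * \<delta>"
  shows "ecc G (P ! i) \<le> ecc G (P ! k) - (real i - real k) + 2 * \<delta>"
    and "ecc G (P ! i) \<le> ecc G (P ! k) + \<delta>"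
proof -
  let ?n = "length P - 1"
  have V: "P ! k \<in> verts G" "P ! i \<in> verts G" "P ! ?n \<in> verts G"
    using shortest_path_nth_in_verts assms by auto
  have d: "gdist G (P ! k) (P ! i) = real i - real k"
    "gdist G (P ! i) (P ! ?n) = real ?n - real i" "gdist G (P ! k) (P ! ?n) = real ?n - real k"
    by (rule gdist_segment; use assms in simp)+
  have between: "gdist G (P ! k) (P ! i) + gdist G (P ! i) (P ! ?n) = gdist G (P ! k) (P ! ?n)"
    unfolding d by simp
  have far: "gdist G (P ! i) (P ! ?n) > 2 * \<delta>" unfolding d by (rule assms(3))
  note * = ecc_between_le[OF hyp V between ecc_end_le[OF assms(2)] far]
  show "ecc G (P ! i) \<le> ecc G (P ! k) - (real i - real k) + 2 * \<delta>"
    using *(1) unfolding d .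
  show "ecc G (P ! i) \<le> ecc G (P ! k) + \<delta>" by (rule *(2))
qed

lemma ascending_subpath_height_le:
  assumes asc: "ascending_subpath G P i l"
  shows "gdist G (P ! i) (P ! (i + l)) = real l" and "real l \<le> \<delta>"
proof -
  let ?n = "length P - 1"
  have il: "i + l < length P" using asc by (simp add: ascending_subpath_def)
  have V: "P ! i \<in> verts G" "P ! (i + l) \<in> verts G" "P ! ?n \<in> verts G"
    using shortest_path_nth_in_verts il by auto
  show l: "gdist G (P ! i) (P ! (i + l)) = real l"
    using gdist_segment[of i "i + l"] il by simp
  have "gdist G (P ! i) (P ! (i + l)) + gdist G (P ! (i + l)) (P ! ?n) = gdist G (P ! i) (P ! ?n)"
    using gdist_segment[of "i + l" ?n] gdist_segment[of i ?n] il by (simp add: l)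
  then show "real l \<le> \<delta>"
    using ecc_rise_le[OF hyp V] ecc_end_le[of i] ecc_ascending_subpath[OF asc] il l by simp
qed

end

end

end

theorem theorem17:
  fixes G :: "('a, 'b) pre_digraph" and \<delta> :: real and P :: "'a list" and x y :: 'a
  assumes "graph G" and "Digraph_Component.connected G" and "hyperbolic \<delta> G"
    and "shortest_path G y P x" and "end_minimal G P"
  shows "(\<forall>i l. up_hill G P i l \<longrightarrow>
             real l = gdist G (P ! i) (P ! (i + l)) \<and> gdist G (P ! i) (P ! (i + l)) \<le> \<delta>)
       \<and> (\<forall>c \<in> set P. gdist G c x > 2 * \<delta> \<longrightarrow>
             ecc G c \<le> ecc G y + \<delta> \<and> ecc G c \<le> ecc G y - gdist G c y + 2 * \<delta>)
       \<and> (gdist G y x > 4 * \<delta> + 1 \<longrightarrow>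
             (\<forall>i :: nat. real i \<in> {2 * \<delta> + 1 .. real (vwalk_length P) - 2 * \<delta> - 1} \<longrightarrow>
                ecc G (P ! i)
                  < Min {ecc G (P ! k) | k :: nat. real k \<in> {0 .. real i - 2 * \<delta> - 1}}))"
proof -
  interpret connected_graph G
    using assms(1,2) by (simp add: connected_graph_def connected_graph_axioms_def)
  note sp = assms(4) and hyp = assms(3) and em = assms(5)
  let ?n = "length P - 1"
  have y: "y = P ! 0" and x: "x = P ! ?n" and ne: "P \<noteq> []"
    using shortest_path_hd[OF sp] shortest_path_last[OF sp] shortest_path_not_Nil[OF sp] .
  \<comment> \<open>Ensures in (iii) that \<open>real k \<le> real i - 2 * \<delta> - 1\<close>
    forces \<open>k \<le> i\<close>, and that \<open>i\<close> stays inside the path.\<close>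
  have delta: "0 \<le> \<delta>"
    using hyperbolic_nonneg[OF hyp] shortest_path_nth_in_verts[OF sp, of 0] ne by simp
  have i: "real l = gdist G (P ! i) (P ! (i + l)) \<and> gdist G (P ! i) (P ! (i + l)) \<le> \<delta>"
    if "up_hill G P i l" for i l
    using ascending_subpath_height_le[OF sp hyp em, of i l] that by (simp add: up_hill_def)
  have ii: "ecc G c \<le> ecc G y + \<delta> \<and> ecc G c \<le> ecc G y - gdist G c y + 2 * \<delta>"
    if "c \<in> set P" "gdist G c x > 2 * \<delta>" for c
  proof -
    obtain j where j: "j < length P" "c = P ! j"
      using \<open>c \<in> set P\<close> by (auto simp: in_set_conv_nth)
    have "gdist G c x = real ?n - real j"
      unfolding x j(2) using j(1) by (intro gdist_segment[OF sp]) auto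
    moreover have "gdist G c y = real j"
      using gdist_segment[OF sp, of 0 j] j gdist_commute shortest_path_nth_in_verts[OF sp] ne
      by (simp add: y)
    ultimately show ?thesis
      using ecc_path_le[OF sp hyp em, of 0 j] that j y by simp
  qed
  have iii: "ecc G (P ! i) < Min {ecc G (P ! k) | k :: nat. real k \<in> {0 .. real i - 2 * \<delta> - 1}}"
    if "real i \<in> {2 * \<delta> + 1 .. real (vwalk_length P) - 2 * \<delta> - 1}" for i
  proof -
    let ?K = "{k :: nat. real k \<in> {0 .. real i - 2 * \<delta> - 1}}"
    have i_le: "real i \<le> real ?n - 2 * \<delta> - 1" using that by simp
    have "?K \<subseteq> {..i}" using delta by auto
    then have "finite ?K" by (rule finite_subset) simp
    \<comment> \<open>The lower bound \<open>2 * \<delta> + 1\<close> on \<open>i\<close> puts index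
      0 into the set.\<close>
    moreover have "?K \<noteq> {}" using that by (auto intro!: exI[of _ 0])
    moreover have "ecc G (P ! i) < ecc G (P ! k)" if "k \<in> ?K" for k
    proof -
      have k: "real k \<le> real i - 2 * \<delta> - 1" using that by simp
      have "k \<le> i" "i < length P" "real ?n - real i > 2 * \<delta>"
        using k i_le delta by linarith+
      \<comment> \<open>Here \<open>real i - real k\<close> is at least
        \<open>2 * \<delta> + 1\<close>, so the bound drops to \<open>ecc G (P ! k) - 1\<close>,
        whence the strict inequality.\<close>
      then show ?thesis using ecc_path_le(1)[OF sp hyp em, of k i] k by linarith
    qed
    ultimately have "ecc G (P ! i) < Min ((\<lambda>k. ecc G (P ! k)) ` ?K)"
      by (subst Min_gr_iff) auto
    then show ?thesis by (simp only: setcompr_eq_image)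
  qed
  show ?thesis using i ii iii by blast
qed

end
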